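(* Let $\delta\ge1$ be an integer. Let $\tau(\mathcal{W}_n)$ be the weighted counting of spanning trees in the weighted graph $\mathcal{W}_n$. Then, for all $n\ge0$, $$\tau(\mathcal{W}_n)=3^{\frac{3 (\delta +4)^n+\delta }{\delta +3}} (\delta +1)^{\frac{2 \left(3 \left((\delta +4)^n-1\right)+\delta (\delta +3) n\right)}{(\delta +3)^2}}.$$
   Context: For a weighted graph $\mathcal{G}$, the weighted counting of spanning trees is $\tau(\mathcal{G})=\sum_{\zeta}\prod_{e\in\zeta}w_e$, where the sum is over all spanning trees $\zeta$ of $\mathcal{G}$ and $w_e$ is the weight of edge $e$. The strength of a vertex $i$ in a weighted graph is $s_i=\sum_j w_{ij}$, the sum of the weights of its incident edges. The weighted graphs $\mathcal{W}_n$ ($n\ge 0$) are defined recursively for a fixed integer $\delta\ge1$. $\mathcal{W}_0$ is a triangle whose three edges have weight $1$. For $n\ge1$, $\mathcal{W}_n$ is obtained from $\mathcal{W}_{n-1}$ as follows: (I) for each vertex $i$ of $\mathcal{W}_{n-1}$, of strength $s_i$ in $\mathcal{W}_{n-1}$ (always an even integer), take $s_i/2$ new disjoint copies of $\mathcal{K}_2$ (two vertices joined by an edge of weight $1$) and join both vertices of each copy to $i$ by edges of weight $1$; (II) multiply the weight of every edge that already belonged to $\mathcal{W}_{n-1}$ by $1+\delta$. *)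

theory Defs
  imports Complex_Main
begin

section \<open>Weighted graphs and their weighted spanning tree count\<close>

text \<open>
  Edges are two-element sets of vertices. The value of the weight function outside the edge set
  carries no meaning. AFP's Graph_Theory is not used here because its notion of forest excludes
  directed cycles only, so its spanning_tree is not the undirected one.
\<close>

record ('v, 'w) wgraph =
  wverts :: "'v set"
  wedges :: "'v set set"
  weight :: "'v set \<Rightarrow> 'w"

definition simple_wgraph :: "('v, 'w) wgraph \<Rightarrow> bool" where
  "simple_wgraph G \<longleftrightarrow> finite (wverts G) \<and> (\<forall>e\<in>wedges G. e \<subseteq> wverts G \<and> card e = 2)"

definition strength :: "('v, 'w::comm_semiring_1) wgraph \<Rightarrow> 'v \<Rightarrow> 'w" where
  "strength G i = (\<Sum>e | e \<in> wedges G \<and> i \<in> e. weight G e)"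

definition edges_connect :: "'v set \<Rightarrow> 'v set set \<Rightarrow> bool" where
  "edges_connect V F \<longleftrightarrow> (\<forall>u\<in>V. \<forall>v\<in>V. (u, v) \<in> {(x, y). {x, y} \<in> F}\<^sup>*)"

definition is_cycle :: "'v set set \<Rightarrow> 'v list \<Rightarrow> bool" where
  "is_cycle F c \<longleftrightarrow> length c \<ge> 3 \<and> distinct c \<and>
     (\<forall>i<length c. {c ! i, c ! (Suc i mod length c)} \<in> F)"

text \<open>A spanning tree is identified with its edge set.\<close>

definition is_spanning_tree :: "('v, 'w) wgraph \<Rightarrow> 'v set set \<Rightarrow> bool" where
  "is_spanning_tree G F \<longleftrightarrow>
     F \<subseteq> wedges G \<and> edges_connect (wverts G) F \<and> (\<nexists>c. is_cycle F c)"

definition weighted_tree_count :: "('v, 'w::comm_semiring_1) wgraph \<Rightarrow> 'w" where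
  "weighted_tree_count G = (\<Sum>F | is_spanning_tree G F. \<Prod>e\<in>F. weight G e)"


section \<open>The recursive family\<close>

text \<open>
  \<open>Born n i k b\<close> is the endpoint \<open>b\<close> of the \<open>k\<close>-th copy of \<open>K\<^sub>2\<close> attached to vertex \<open>i\<close> in the
  passage from the \<open>n\<close>-th to the \<open>Suc n\<close>-th graph. The stamp \<open>n\<close> keeps the new vertices distinct
  from those created at earlier steps (see \<open>new_verts_fresh\<close> below).
\<close>

datatype vertex = Corner nat | Born nat vertex nat bool

definition triangle :: "(vertex, nat) wgraph" where
  "triangle = \<lparr>wverts = {Corner 0, Corner 1, Corner 2},
     wedges = {{Corner 0, Corner 1}, {Corner 1, Corner 2}, {Corner 2, Corner 0}},
     weight = (\<lambda>_. 1)\<rparr>"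

definition new_verts :: "nat \<Rightarrow> (vertex, nat) wgraph \<Rightarrow> vertex set" where
  "new_verts n G = {Born n i k b | i k b. i \<in> wverts G \<and> k < strength G i div 2}"

definition new_edges :: "nat \<Rightarrow> (vertex, nat) wgraph \<Rightarrow> vertex set set" where
  "new_edges n G = (\<Union>i\<in>wverts G. \<Union>k<strength G i div 2.
     {{Born n i k False, Born n i k True}, {i, Born n i k False}, {i, Born n i k True}})"

text \<open>Halving the strength loses nothing, since strengths are even (see \<open>even_strength\<close> below).\<close>

definition grow :: "nat \<Rightarrow> nat \<Rightarrow> (vertex, nat) wgraph \<Rightarrow> (vertex, nat) wgraph" where
  "grow \<delta> n G = \<lparr>wverts = wverts G \<union> new_verts n G,
     wedges = wedges G \<union> new_edges n G,
     weight = (\<lambda>e. if e \<in> wedges G then (1 + \<delta>) * weight G e else 1)\<rparr>"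

primrec W_graph :: "nat \<Rightarrow> nat \<Rightarrow> (vertex, nat) wgraph" where
  "W_graph \<delta> 0 = triangle"
| "W_graph \<delta> (Suc n) = grow \<delta> n (W_graph \<delta> n)"


section \<open>Well-definedness of the construction\<close>

lemma stamp_less: "Born m i k b \<in> wverts (W_graph \<delta> n) \<Longrightarrow> m < n"
  by (induction n arbitrary: m i k b)
     (auto simp: triangle_def grow_def new_verts_def intro: less_SucI)

lemma new_verts_fresh: "wverts (W_graph \<delta> n) \<inter> new_verts n (W_graph \<delta> n) = {}"
  using stamp_less[of n _ _ _ \<delta> n] by (auto simp: new_verts_def)

lemma finite_new_verts:
  assumes "finite (wverts G)"
  shows "finite (new_verts n G)"
proof -
  have "new_verts n G = (\<Union>i\<in>wverts G. \<Union>k<strength G i div 2. \<Union>b. {Born n i k b})"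
    by (auto simp: new_verts_def)
  then show ?thesis using assms by simp
qed

lemma simple_W_graph: "simple_wgraph (W_graph \<delta> n)"
proof (induction n)
  case 0
  show ?case by (auto simp: simple_wgraph_def triangle_def card_insert_if)
next
  case (Suc n)
  let ?G = "W_graph \<delta> n"
  have ne: "i \<noteq> Born n j k b" if "i \<in> wverts ?G" for i j k b
    using that stamp_less[of n j k b \<delta> n] by auto
  have "e \<subseteq> wverts ?G \<union> new_verts n ?G \<and> card e = 2" if "e \<in> new_edges n ?G" for e
    using that ne by (auto simp: new_edges_def new_verts_def card_insert_if)
  then show ?case
    using Suc finite_new_verts[of ?G n] by (auto simp: simple_wgraph_def grow_def)
qed

lemma even_strength:
  assumes "i \<in> wverts (W_graph \<delta> n)"
  shows "even (strength (W_graph \<delta> n) i)"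
  using assms
proof (induction n arbitrary: i)
  case 0
  have inc: "{e. e \<in> wedges triangle \<and> Corner 0 \<in> e} = {{Corner 0, Corner 1}, {Corner 2, Corner 0}}"
    "{e. e \<in> wedges triangle \<and> Corner (Suc 0) \<in> e} = {{Corner 0, Corner 1}, {Corner 1, Corner 2}}"
    "{e. e \<in> wedges triangle \<and> Corner 2 \<in> e} = {{Corner 1, Corner 2}, {Corner 2, Corner 0}}"
    by (auto simp: triangle_def)
  have "strength triangle (Corner j) = 2" if "j \<in> {0, 1, 2}" for j
    using that by (auto simp: strength_def inc) (auto simp: triangle_def doubleton_eq_iff)
  moreover obtain j where "j \<in> {0, 1, 2}" "i = Corner j"
    using 0 by (auto simp: triangle_def)
  ultimately show ?case by simp
next
  case (Suc n)
  let ?G = "W_graph \<delta> n" and ?H = "W_graph \<delta> (Suc n)"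
  let ?E = "{e. e \<in> wedges ?G \<and> i \<in> e}" and ?N = "{e. e \<in> new_edges n ?G \<and> i \<in> e}"
  have ne: "i' \<noteq> Born n j k b" "Born n j k b \<noteq> i'" if "i' \<in> wverts ?G" for i' j k b
    using that stamp_less[of n j k b \<delta> n] by auto
  have old: "e \<subseteq> wverts ?G" if "e \<in> wedges ?G" for e
    using that simple_W_graph[of \<delta> n] by (auto simp: simple_wgraph_def)
  have disj: "e \<notin> wedges ?G" if new: "e \<in> new_edges n ?G" for e
  proof
    assume "e \<in> wedges ?G"
    then have "e \<subseteq> wverts ?G" by (rule old)
    moreover obtain j k b where "Born n j k b \<in> e"
      using new unfolding new_edges_def by blast
    ultimately show False using ne by blast
  qed
  have finG: "finite (wverts ?G)"
    using simple_W_graph[of \<delta> n] by (auto simp: simple_wgraph_def)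
  have finE: "finite ?E"
    using old finG by (intro finite_subset[of ?E "Pow (wverts ?G)"]) auto
  have finN: "finite ?N"
    using finG by (simp add: new_edges_def)
  have "{e. e \<in> wedges ?H \<and> i \<in> e} = ?E \<union> ?N"
    by (auto simp: grow_def)
  then have "strength ?H i = (\<Sum>e\<in>?E \<union> ?N. weight ?H e)"
    by (simp add: strength_def)
  also have "\<dots> = (\<Sum>e\<in>?E. weight ?H e) + (\<Sum>e\<in>?N. weight ?H e)"
    by (rule sum.union_disjoint[OF finE finN]) (use disj in auto)
  also have "(\<Sum>e\<in>?E. weight ?H e) = (1 + \<delta>) * strength ?G i"
    by (simp add: grow_def strength_def sum_distrib_left)
  also have "(\<Sum>e\<in>?N. weight ?H e) = card ?N"
    using disj by (simp add: grow_def)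
  finally have eq: "strength ?H i = (1 + \<delta>) * strength ?G i + card ?N" .
  show ?case
  proof (cases "i \<in> wverts ?G")
    case True
    let ?f = "\<lambda>(k, b). {i, Born n i k b}"
    have "?N = ?f ` ({..<strength ?G i div 2} \<times> UNIV)"
    proof (intro subset_antisym subsetI)
      fix e assume "e \<in> ?N"
      then show "e \<in> ?f ` ({..<strength ?G i div 2} \<times> UNIV)"
        using ne[OF True] by (auto simp: new_edges_def)
    next
      fix e assume "e \<in> ?f ` ({..<strength ?G i div 2} \<times> UNIV)"
      then obtain k b where "k < strength ?G i div 2" "e = {i, Born n i k b}" by auto
      then show "e \<in> ?N" using True by (cases b) (auto simp: new_edges_def)
    qed
    moreover have "inj_on ?f ({..<strength ?G i div 2} \<times> UNIV)"
      using ne[OF True] by (auto simp: inj_on_def doubleton_eq_iff)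
    ultimately have "card ?N = 2 * (strength ?G i div 2)"
      by (simp add: card_image card_cartesian_product)
    then show ?thesis using Suc.IH[OF True] unfolding eq by simp
  next
    case False
    then obtain j k b where i: "i = Born n j k b" "j \<in> wverts ?G" "k < strength ?G j div 2"
      using Suc.prems by (auto simp: grow_def new_verts_def)
    have "?E = {}" using False old by blast
    then have "strength ?G i = 0" by (simp only: strength_def sum.empty)
    have "?N = {{Born n j k False, Born n j k True}, {j, i}}"
    proof (intro subset_antisym subsetI)
      fix e assume "e \<in> ?N"
      then show "e \<in> {{Born n j k False, Born n j k True}, {j, i}}"
        using i ne by (auto simp: new_edges_def)
    next
      fix e assume "e \<in> {{Born n j k False, Born n j k True}, {j, i}}"
      then show "e \<in> ?N" using i by (cases b) (auto simp: new_edges_def)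
    qed
    moreover have "{Born n j k False, Born n j k True} \<noteq> {j, i}"
      using i ne by (auto simp: doubleton_eq_iff)
    ultimately have "card ?N = 2" by simp
    with \<open>strength ?G i = 0\<close> show ?thesis unfolding eq by simp
  qed
qed

end

theory Submission
  imports Defs
begin

text \<open>
  Attaching a triangle with two new vertices at an old vertex means choosing two of its three edges
  in a spanning tree, so it triples the count when the new edges have weight \<open>1\<close>. Rescaling all
  weights of a graph with \<open>N\<close> vertices by \<open>1 + \<delta>\<close> multiplies the count by \<open>(1 + \<delta>) ^ (N - 1)\<close>. By
  the handshake lemma the number of triangles attached at a step is the total edge weight \<open>W\<close>, so
  \<open>N' = N + 2 W\<close>, \<open>W' = (\<delta> + 4) W\<close> and \<open>\<tau>' = 3 ^ W (1 + \<delta>) ^ (N - 1) \<tau>\<close>, which is solved explicitly.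
\<close>

section \<open>Connectivity and cycles when a leaf is added\<close>

text \<open>A walk that starts inside \<open>S\<close> and ends outside it has to leave
  \<open>S\<close> along some edge; induction along the walk finds that edge.\<close>

lemma edges_connect_crossing:
  assumes "edges_connect V F" "x \<in> V" "y \<in> V" "x \<in> S" "y \<notin> S"
  obtains p q where "p \<in> S" "q \<notin> S" "{p, q} \<in> F"
proof -
  have "(x, y) \<in> {(x, y). {x, y} \<in> F}\<^sup>*"
    using assms by (auto simp: edges_connect_def)
  then have "y \<notin> S \<longrightarrow> (\<exists>p q. p \<in> S \<and> q \<notin> S \<and> {p, q} \<in> F)"
    by (induction rule: rtrancl_induct) (use assms in auto)
  then show thesis using assms that by blast
qed

lemma edges_connect_leaf:
  assumes F: "\<And>e. e \<in> F \<Longrightarrow> e \<subseteq> V" and u: "u \<in> V" and v: "v \<notin> V"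
  shows "edges_connect (insert v V) (insert {u, v} F) \<longleftrightarrow> edges_connect V F"
proof
  let ?R = "{(x, y). {x, y} \<in> F}" and ?R' = "{(x, y). {x, y} \<in> insert {u, v} F}"
  {
    \<comment> \<open>\<open>r\<close> retracts the enlarged graph onto the old one by folding
      \<open>v\<close> onto \<open>u\<close>. The leaf edge collapses to a trivial step and every
      other step is kept, so walks through \<open>v\<close> become walks in
      \<open>F\<close>.\<close>
    define r where "r x = (if x = v then u else x)" for x
    have step: "(r x, r y) \<in> ?R\<^sup>*" if "(x, y) \<in> ?R'" for x y
    proof (cases "{x, y} = {u, v}")
      case True
      then show ?thesis by (auto simp: r_def doubleton_eq_iff)
    next
      case False
      then have "{x, y} \<in> F" using that by auto
      moreover from this F v have "x \<noteq> v" "y \<noteq> v" by auto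
      ultimately show ?thesis by (auto simp: r_def)
    qed
    have path: "(r x, r y) \<in> ?R\<^sup>*" if "(x, y) \<in> ?R'\<^sup>*" for x y
      using that by (induction rule: rtrancl_induct) (use step in \<open>auto intro: rtrancl_trans\<close>)
    assume conn: "edges_connect (insert v V) (insert {u, v} F)"
    show "edges_connect V F"
      unfolding edges_connect_def
    proof (intro ballI)
      fix x y assume xy: "x \<in> V" "y \<in> V"
      then have "(x, y) \<in> ?R'\<^sup>*" using conn by (auto simp: edges_connect_def)
      from path[OF this] show "(x, y) \<in> ?R\<^sup>*" using xy v by (auto simp: r_def split: if_splits)
    qed
  next
    assume "edges_connect V F"
    moreover have "?R\<^sup>* \<subseteq> ?R'\<^sup>*" by (rule rtrancl_mono) auto
    ultimately have old: "(x, y) \<in> ?R'\<^sup>*" if "x \<in> V" "y \<in> V" for x y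
      using that by (auto simp: edges_connect_def)
    have leaf: "(u, v) \<in> ?R'\<^sup>*" "(v, u) \<in> ?R'\<^sup>*"
      by (auto intro!: r_into_rtrancl simp: insert_commute)
    show "edges_connect (insert v V) (insert {u, v} F)"
      unfolding edges_connect_def
    proof (intro ballI)
      fix x y assume "x \<in> insert v V" "y \<in> insert v V"
      moreover have "(x, u) \<in> ?R'\<^sup>*" if "x \<in> insert v V" for x
        using that leaf old u by auto
      moreover have "(u, y) \<in> ?R'\<^sup>*" if "y \<in> insert v V" for y
        using that leaf old u by auto
      ultimately show "(x, y) \<in> ?R'\<^sup>*" by (meson rtrancl_trans)
    qed
  }
qed

lemma is_cycle_mono: "is_cycle F c \<Longrightarrow> F \<subseteq> F' \<Longrightarrow> is_cycle F' c"
  unfolding is_cycle_def by blast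

text \<open>Every vertex of a cycle has two distinct neighbours on it, whereas \<open>v\<close> has
  \<open>u\<close> as its only neighbour; hence no cycle visits \<open>v\<close>.\<close>

lemma is_cycle_leaf:
  assumes F: "\<And>e. e \<in> F \<Longrightarrow> v \<notin> e" and uv: "u \<noteq> v"
  shows "is_cycle (insert {u, v} F) c \<longleftrightarrow> is_cycle F c"
proof
  assume cyc: "is_cycle (insert {u, v} F) c"
  let ?L = "length c"
  have L: "?L \<ge> 3" and dist: "distinct c"
    and edge: "\<And>i. i < ?L \<Longrightarrow> {c ! i, c ! (Suc i mod ?L)} \<in> insert {u, v} F"
    using cyc by (auto simp: is_cycle_def)
  have nbr: "x = u" if "{x, v} \<in> insert {u, v} F" for x
    using that F uv by (auto simp: doubleton_eq_iff)
  have "v \<notin> set c"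
  proof
    assume "v \<in> set c"
    then obtain i where i: "i < ?L" "c ! i = v" by (auto simp: in_set_conv_nth)
    \<comment> \<open>\<open>j\<close> and \<open>k\<close> are the cyclic predecessor and successor
      of position \<open>i\<close>. Both carry \<open>u\<close>, so distinctness gives
      \<open>j = k\<close>, which a cycle of length at least 3 rules out.\<close>
    define j where "j = (if i = 0 then ?L - 1 else i - 1)"
    define k where "k = (if Suc i = ?L then 0 else Suc i)"
    have j: "j < ?L" "Suc j mod ?L = i" using i L by (auto simp: j_def)
    have k: "k < ?L" "Suc i mod ?L = k" using i L by (auto simp: k_def)
    have "c ! j = u" using edge[OF j(1)] j i nbr by simp
    moreover have "c ! k = u" using edge[OF i(1)] k i nbr[of "c ! k"] by (simp add: insert_commute)
    ultimately have "j = k" using dist j(1) k(1) nth_eq_iff_index_eq by metis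
    then show False using i L by (auto simp: j_def k_def split: if_splits)
  qed
  moreover have "c ! i \<in> set c" "c ! (Suc i mod ?L) \<in> set c" if "i < ?L" for i
    using that L by (auto intro!: nth_mem mod_less_divisor)
  ultimately have "{c ! i, c ! (Suc i mod ?L)} \<in> F" if "i < ?L" for i
    using edge[OF that] that by (metis doubleton_eq_iff insertE)
  then show "is_cycle F c" using L dist by (auto simp: is_cycle_def)
qed (auto elim: is_cycle_mono)

text \<open>Separates the tree property from weights and from the ambient edge set, so that vertices
  and edges can be added one at a time.\<close>

definition tree_on :: "'v set \<Rightarrow> 'v set set \<Rightarrow> bool" where
  "tree_on V F \<longleftrightarrow> edges_connect V F \<and> (\<nexists>c. is_cycle F c)"

lemma is_spanning_tree_iff:
  "is_spanning_tree G F \<longleftrightarrow> F \<subseteq> wedges G \<and> tree_on (wverts G) F"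
  by (simp add: is_spanning_tree_def tree_on_def)

lemma tree_on_leaf:
  assumes "\<And>e. e \<in> F \<Longrightarrow> e \<subseteq> V" "u \<in> V" "v \<notin> V"
  shows "tree_on (insert v V) (insert {u, v} F) \<longleftrightarrow> tree_on V F"
proof -
  have "is_cycle (insert {u, v} F) c \<longleftrightarrow> is_cycle F c" for c
    by (rule is_cycle_leaf) (use assms in auto)
  then show ?thesis using edges_connect_leaf[OF assms] by (simp add: tree_on_def)
qed

section \<open>Trees after attaching a triangle at a vertex\<close>

definition triangle_edges :: "'v \<Rightarrow> 'v \<Rightarrow> 'v \<Rightarrow> 'v set set" where
  "triangle_edges i a b = {{a, b}, {i, a}, {i, b}}"

text \<open>These are the three spanning trees of the triangle with vertices \<open>i\<close>,
  \<open>a\<close>, \<open>b\<close>.\<close>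

definition triangle_paths :: "'v \<Rightarrow> 'v \<Rightarrow> 'v \<Rightarrow> 'v set set set" where
  "triangle_paths i a b = {{{i, a}, {i, b}}, {{i, a}, {a, b}}, {{i, b}, {a, b}}}"

text \<open>Each of the three paths arises by adding two leaves in succession, so
  \<open>tree_on_leaf\<close> applies twice.\<close>

lemma tree_on_triangle_path:
  assumes F: "\<And>e. e \<in> F \<Longrightarrow> e \<subseteq> V" and i: "i \<in> V" and ab: "a \<notin> V" "b \<notin> V" "a \<noteq> b"
    and P: "P \<in> triangle_paths i a b"
  shows "tree_on (insert a (insert b V)) (F \<union> P) \<longleftrightarrow> tree_on V F"
proof -
  \<comment> \<open>First \<open>x\<close> is hung on \<open>i\<close>, then \<open>y\<close> on
    \<open>u\<close>. The choices \<open>u = i\<close> and \<open>u = x\<close>, with either new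
    vertex in the role of \<open>x\<close>, cover all three paths.\<close>
  have two: "tree_on (insert y (insert x V)) (insert {u, y} (insert {i, x} F)) \<longleftrightarrow> tree_on V F"
    if "x \<notin> V" "y \<notin> V" "x \<noteq> y" "u \<in> insert x V" for x y u
  proof -
    have "tree_on (insert y (insert x V)) (insert {u, y} (insert {i, x} F)) \<longleftrightarrow>
        tree_on (insert x V) (insert {i, x} F)"
      by (rule tree_on_leaf) (use that F i in auto)
    then show ?thesis using tree_on_leaf[OF F i that(1)] by simp
  qed
  from P consider "P = {{i, a}, {i, b}}" | "P = {{i, a}, {a, b}}" | "P = {{i, b}, {a, b}}"
    by (auto simp: triangle_paths_def)
  then show ?thesis
  proof cases
    case 1
    then show ?thesis using two[of a b i] ab i by (simp add: insert_commute)
  next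
    case 2
    then show ?thesis using two[of a b a] ab i by (simp add: insert_commute)
  next
    case 3
    then show ?thesis using two[of b a b] ab i by (simp add: insert_commute)
  qed
qed

text \<open>The propositional core of the next lemma, with \<open>p\<close>, \<open>q\<close>,
  \<open>r\<close> standing for the edges \<open>{i, a}\<close>, \<open>{i, b}\<close>,
  \<open>{a, b}\<close>.\<close>

lemma two_of_three:
  assumes "p \<in> Q \<or> r \<in> Q" "q \<in> Q \<or> r \<in> Q" "p \<in> Q \<or> q \<in> Q"
    and "\<not> (p \<in> Q \<and> r \<in> Q \<and> q \<in> Q)" "Q \<subseteq> {r, p, q}"
  shows "Q \<in> {{p, q}, {p, r}, {q, r}}"
  using assms by (cases "p \<in> Q"; cases "q \<in> Q") auto

text \<open>Connectivity across the cuts \<open>{a}\<close>, \<open>{b}\<close> and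
  \<open>{a, b}\<close> puts an edge from each pair of triangle edges into \<open>Q\<close>, and
  acyclicity forbids having all three.\<close>

lemma tree_on_triangle_edges:
  assumes F: "\<And>e. e \<in> F \<Longrightarrow> e \<subseteq> V" and i: "i \<in> V" and ab: "a \<notin> V" "b \<notin> V" "a \<noteq> b"
    and Q: "Q \<subseteq> triangle_edges i a b" and tree: "tree_on (insert a (insert b V)) (F \<union> Q)"
  shows "Q \<in> triangle_paths i a b"
proof -
  have conn: "edges_connect (insert a (insert b V)) (F \<union> Q)" and acyc: "\<nexists>c. is_cycle (F \<union> Q) c"
    using tree by (auto simp: tree_on_def)
  have ne: "i \<noteq> a" "i \<noteq> b" using i ab by auto
  \<comment> \<open>Edges of \<open>F\<close> stay inside \<open>V\<close> and so never touch
    \<open>S\<close>; the crossing edge must come from \<open>Q\<close>.\<close>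
  have cut: "\<exists>p q. p \<in> S \<and> q \<notin> S \<and> {p, q} \<in> Q" if S: "x \<in> S" "S \<subseteq> {a, b}" for S x
  proof -
    obtain p q where "p \<in> S" "q \<notin> S" "{p, q} \<in> F \<union> Q"
      by (rule edges_connect_crossing[OF conn, of x i S]) (use S i ne in auto)
    then show ?thesis using F ab S by blast
  qed
  have A: "{i, a} \<in> Q \<or> {a, b} \<in> Q"
    using cut[of a "{a}"] Q by (auto simp: triangle_edges_def doubleton_eq_iff)
  have B: "{i, b} \<in> Q \<or> {a, b} \<in> Q"
  proof -
    obtain q where "q \<noteq> b" and q: "{b, q} \<in> Q"
      using cut[of b "{b}"] by auto
    then have "q = a \<or> q = i" using Q by (auto simp: triangle_edges_def doubleton_eq_iff)
    then show ?thesis using q by (auto simp: insert_commute)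
  qed
  have C: "{i, a} \<in> Q \<or> {i, b} \<in> Q"
    using cut[of b "{a, b}"] Q by (auto simp: triangle_edges_def doubleton_eq_iff insert_commute)
  have D: "\<not> ({i, a} \<in> Q \<and> {a, b} \<in> Q \<and> {i, b} \<in> Q)"
  proof
    assume "{i, a} \<in> Q \<and> {a, b} \<in> Q \<and> {i, b} \<in> Q"
    then have "{i, a} \<in> Q" "{a, b} \<in> Q" "{b, i} \<in> Q" by (simp_all add: insert_commute)
    then have "is_cycle (F \<union> Q) [i, a, b]"
      using ne ab by (simp add: is_cycle_def All_less_Suc)
    then show False using acyc by blast
  qed
  show ?thesis
    unfolding triangle_paths_def
    by (rule two_of_three[OF A B C D Q[unfolded triangle_edges_def]])
qed

section \<open>Attaching one triangle to a weighted graph\<close>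

text \<open>The weight function is kept: its values outside \<open>wedges G\<close> become the
  weights of the new edges.\<close>

definition add_triangle :: "('v, 'w) wgraph \<Rightarrow> 'v \<Rightarrow> 'v \<Rightarrow> 'v \<Rightarrow> ('v, 'w) wgraph" where
  "add_triangle G i a b = \<lparr>wverts = insert a (insert b (wverts G)),
     wedges = wedges G \<union> triangle_edges i a b, weight = weight G\<rparr>"

definition spanning_trees :: "('v, 'w) wgraph \<Rightarrow> 'v set set set" where
  "spanning_trees G = {F. is_spanning_tree G F}"

definition total_weight :: "('v, 'w::comm_semiring_1) wgraph \<Rightarrow> 'w" where
  "total_weight G = (\<Sum>e\<in>wedges G. weight G e)"

lemma finite_wedges:
  assumes "simple_wgraph G"
  shows "finite (wedges G)"
  using assms by (intro finite_subset[of "wedges G" "Pow (wverts G)"]) (auto simp: simple_wgraph_def)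

locale triangle_attachment =
  fixes G :: "('v, 'w::comm_semiring_1) wgraph" and i a b :: 'v
  assumes simple: "simple_wgraph G"
    and i: "i \<in> wverts G" and a: "a \<notin> wverts G" and b: "b \<notin> wverts G" and ab: "a \<noteq> b"
begin

lemma old_edge: "e \<in> wedges G \<Longrightarrow> e \<subseteq> wverts G"
  using simple by (auto simp: simple_wgraph_def)

lemma disjoint: "wedges G \<inter> triangle_edges i a b = {}"
  using old_edge a b by (auto simp: triangle_edges_def)

lemma card_triangle_edges: "card (triangle_edges i a b) = 3"
  using i a b ab by (auto simp: triangle_edges_def card_insert_if doubleton_eq_iff)

lemma triangle_path:
  assumes "P \<in> triangle_paths i a b"
  shows "P \<subseteq> triangle_edges i a b" "card P = 2"
  using assms i a b ab
  by (auto simp: triangle_paths_def triangle_edges_def card_insert_if doubleton_eq_iff)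

lemma card_triangle_paths: "card (triangle_paths i a b) = 3"
proof -
  have "{i, a} \<noteq> {i, b}" "{i, a} \<noteq> {a, b}" "{i, b} \<noteq> {a, b}"
    using i a b ab by (auto simp: doubleton_eq_iff)
  then show ?thesis by (auto simp: triangle_paths_def card_insert_if doubleton_eq_iff)
qed

lemma simple_add_triangle: "simple_wgraph (add_triangle G i a b)"
  using simple i a b ab
  by (auto simp: simple_wgraph_def add_triangle_def triangle_edges_def card_insert_if)

lemma card_wverts_add_triangle: "card (wverts (add_triangle G i a b)) = card (wverts G) + 2"
  using simple a b ab by (auto simp: simple_wgraph_def add_triangle_def)

text \<open>The triangle meets the old graph only in \<open>i\<close>, so a spanning tree splits
  into its old edges and its triangle edges, and the two choices are independent.\<close>

lemma spanning_trees_add_triangle: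
  "spanning_trees (add_triangle G i a b) =
    (\<lambda>(F, P). F \<union> P) ` (spanning_trees G \<times> triangle_paths i a b)"
proof (intro subset_antisym subsetI)
  fix F assume "F \<in> spanning_trees (add_triangle G i a b)"
  then have sub: "F \<subseteq> wedges G \<union> triangle_edges i a b"
    and tree: "tree_on (insert a (insert b (wverts G))) F"
    by (auto simp: spanning_trees_def is_spanning_tree_iff add_triangle_def)
  let ?F = "F \<inter> wedges G" and ?P = "F \<inter> triangle_edges i a b"
  have eq: "F = ?F \<union> ?P" using sub by blast
  have F: "e \<subseteq> wverts G" if "e \<in> ?F" for e
    using that old_edge by auto
  have tree': "tree_on (insert a (insert b (wverts G))) (?F \<union> ?P)"
    using tree eq by simp
  have P: "?P \<in> triangle_paths i a b"
    by (rule tree_on_triangle_edges[OF F i a b ab _ tree']) auto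
  have "?F \<in> spanning_trees G"
    using tree' tree_on_triangle_path[of ?F, OF F i a b ab P]
    by (simp add: spanning_trees_def is_spanning_tree_iff)
  with P eq show "F \<in> (\<lambda>(F, P). F \<union> P) ` (spanning_trees G \<times> triangle_paths i a b)"
    by (auto intro!: image_eqI[of _ _ "(?F, ?P)"])
next
  fix F' assume "F' \<in> (\<lambda>(F, P). F \<union> P) ` (spanning_trees G \<times> triangle_paths i a b)"
  then obtain F P where F': "F' = F \<union> P" and F: "F \<subseteq> wedges G" "tree_on (wverts G) F"
    and P: "P \<in> triangle_paths i a b"
    by (auto simp: spanning_trees_def is_spanning_tree_iff)
  have "tree_on (insert a (insert b (wverts G))) (F \<union> P)"
    using tree_on_triangle_path[OF _ i a b ab P, of F] F old_edge by blast
  then show "F' \<in> spanning_trees (add_triangle G i a b)"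
    using F F' triangle_path(1)[OF P]
    by (auto simp: spanning_trees_def is_spanning_tree_iff add_triangle_def)
qed

text \<open>The last two equations recover \<open>F\<close> and \<open>P\<close> from their union
  and give injectivity; the first three allow cardinalities and products to be split over the
  union.\<close>

lemma union_path:
  assumes "F \<in> spanning_trees G" "P \<in> triangle_paths i a b"
  shows "finite F" "finite P" "F \<inter> P = {}"
    "(F \<union> P) \<inter> wedges G = F" "(F \<union> P) \<inter> triangle_edges i a b = P"
proof -
  have F: "F \<subseteq> wedges G"
    using assms by (auto simp: spanning_trees_def is_spanning_tree_iff)
  then show "finite F" using finite_wedges[OF simple] finite_subset by blast
  show "finite P" using triangle_path(2)[OF assms(2)] card.infinite by force
  show "F \<inter> P = {}" "(F \<union> P) \<inter> wedges G = F" "(F \<union> P) \<inter> triangle_edges i a b = P"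
    using F disjoint triangle_path(1)[OF assms(2)] by auto
qed

lemma inj_on_union_path:
  "inj_on (\<lambda>(F, P). F \<union> P) (spanning_trees G \<times> triangle_paths i a b)"
proof (rule inj_onI, clarify)
  fix F P F' P'
  assume "F \<in> spanning_trees G" "P \<in> triangle_paths i a b"
    "F' \<in> spanning_trees G" "P' \<in> triangle_paths i a b" "F \<union> P = F' \<union> P'"
  then show "F = F' \<and> P = P'" by (metis union_path(4,5))
qed

text \<open>Two new vertices are matched by the two edges of a path. The edge count of spanning
  trees is thus carried along the construction as an invariant.\<close>

lemma card_spanning_tree_add_triangle:
  assumes "\<And>F. F \<in> spanning_trees G \<Longrightarrow> Suc (card F) = card (wverts G)"
    and "F \<in> spanning_trees (add_triangle G i a b)"
  shows "Suc (card F) = card (wverts (add_triangle G i a b))"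
  using assms union_path(1-3) triangle_path(2)
  by (auto simp: spanning_trees_add_triangle card_wverts_add_triangle card_Un_disjoint)

context
  assumes unit: "\<And>e. e \<in> triangle_edges i a b \<Longrightarrow> weight G e = 1"
begin

lemma total_weight_add_triangle: "total_weight (add_triangle G i a b) = total_weight G + 3"
proof -
  have "total_weight (add_triangle G i a b) =
      total_weight G + (\<Sum>e\<in>triangle_edges i a b. weight G e)"
    using sum.union_disjoint[OF finite_wedges[OF simple] _ disjoint, of "weight G"]
    by (simp add: total_weight_def add_triangle_def triangle_edges_def)
  then show ?thesis using unit card_triangle_edges by simp
qed

text \<open>A path contributes the factor 1, so the product over \<open>F \<union> P\<close> depends
  on \<open>F\<close> alone and each \<open>F\<close> is counted once for each of the three
  paths.\<close>

lemma weighted_tree_count_add_triangle: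
  "weighted_tree_count (add_triangle G i a b) = 3 * weighted_tree_count G"
proof -
  have "weighted_tree_count (add_triangle G i a b) =
      (\<Sum>F\<in>spanning_trees (add_triangle G i a b). \<Prod>e\<in>F. weight G e)"
    by (simp add: weighted_tree_count_def spanning_trees_def add_triangle_def)
  also have "\<dots> = (\<Sum>(F, P)\<in>spanning_trees G \<times> triangle_paths i a b. \<Prod>e\<in>F \<union> P. weight G e)"
    unfolding spanning_trees_add_triangle
    by (subst sum.reindex[OF inj_on_union_path]) (simp add: case_prod_unfold)
  also have "\<dots> = (\<Sum>(F, P)\<in>spanning_trees G \<times> triangle_paths i a b. \<Prod>e\<in>F. weight G e)"
  proof (intro sum.cong refl, clarify)
    fix F P assume FP: "F \<in> spanning_trees G" "P \<in> triangle_paths i a b"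
    have "(\<Prod>e\<in>P. weight G e) = 1"
      using triangle_path(1)[OF FP(2)] unit by (intro prod.neutral) auto
    then show "(\<Prod>e\<in>F \<union> P. weight G e) = (\<Prod>e\<in>F. weight G e)"
      using prod.union_disjoint[OF union_path(1-3)[OF FP], of "weight G"] by simp
  qed
  also have "\<dots> = 3 * weighted_tree_count G"
    using card_triangle_paths
    by (simp add: sum.cartesian_product[symmetric] sum_distrib_left weighted_tree_count_def
        spanning_trees_def)
  finally show ?thesis .
qed

end

end

section \<open>Attaching a family of triangles\<close>

text \<open>A pair \<open>(i, k)\<close> in \<open>S\<close> stands for the \<open>k\<close>-th
  triangle at vertex \<open>i\<close>. Indexing by an arbitrary set permits induction over single
  triangles.\<close>

definition add_triangles ::
  "nat \<Rightarrow> (vertex \<times> nat) set \<Rightarrow> (vertex, 'w) wgraph \<Rightarrow> (vertex, 'w) wgraph" where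
  "add_triangles n S G = \<lparr>wverts = wverts G \<union> {Born n i k b | i k b. (i, k) \<in> S},
     wedges = wedges G \<union> (\<Union>(i, k)\<in>S. triangle_edges i (Born n i k False) (Born n i k True)),
     weight = weight G\<rparr>"

lemma add_triangles_empty [simp]: "add_triangles n {} G = G"
  by (simp add: add_triangles_def)

lemma add_triangles_insert:
  "add_triangles n (insert (i, k) S) G =
    add_triangle (add_triangles n S G) i (Born n i k False) (Born n i k True)"
proof -
  have "{Born n i' k' b | i' k' b. (i', k') \<in> insert (i, k) S} =
      insert (Born n i k False) (insert (Born n i k True) {Born n i k b | i k b. (i, k) \<in> S})"
    by (auto intro: bool.exhaust)
  then show ?thesis by (auto simp: add_triangles_def add_triangle_def)
qed

text \<open>One induction carries all claims: simplicity of the intermediate graph is what allows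
  the next triangle to be attached, and its edge count for trees feeds the next one.\<close>

lemma add_triangles_facts:
  fixes G :: "(vertex, 'w::comm_semiring_1) wgraph"
  assumes "finite S" "fst ` S \<subseteq> wverts G" "simple_wgraph G"
    and fresh: "\<And>i k b. Born n i k b \<notin> wverts G"
    and unit: "\<And>e. e \<notin> wedges G \<Longrightarrow> weight G e = 1"
    and size: "\<And>F. F \<in> spanning_trees G \<Longrightarrow> Suc (card F) = card (wverts G)"
  shows "simple_wgraph (add_triangles n S G) \<and>
    card (wverts (add_triangles n S G)) = card (wverts G) + 2 * card S \<and>
    total_weight (add_triangles n S G) = total_weight G + 3 * of_nat (card S) \<and>
    (\<forall>F\<in>spanning_trees (add_triangles n S G). Suc (card F) = card (wverts (add_triangles n S G))) \<and>
    weighted_tree_count (add_triangles n S G) = 3 ^ card S * weighted_tree_count G"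
  using assms(1,2)
proof (induction S rule: finite_induct)
  case empty
  then show ?case using assms by simp
next
  case (insert t S)
  obtain i k where t: "t = (i, k)" by (cases t)
  let ?H = "add_triangles n S G" and ?a = "Born n i k False" and ?b = "Born n i k True"
  \<comment> \<open>The endpoints are absent from \<open>G\<close> by \<open>fresh\<close>, and from
    the triangles added earlier because \<open>(i, k)\<close> is not in \<open>S\<close>.\<close>
  interpret triangle_attachment ?H i ?a ?b
    by unfold_locales (use insert t fresh in \<open>auto simp: add_triangles_def\<close>)
  have unit': "weight ?H e = 1" if "e \<in> triangle_edges i ?a ?b" for e
  proof -
    have "e \<notin> wedges G"
      using that fresh assms(3) by (auto simp: triangle_edges_def simple_wgraph_def)
    then show ?thesis using unit by (simp add: add_triangles_def)
  qed
  show ?case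
    unfolding t add_triangles_insert
    using insert t simple_add_triangle card_wverts_add_triangle card_spanning_tree_add_triangle
      total_weight_add_triangle[OF unit'] weighted_tree_count_add_triangle[OF unit']
    by (auto simp: algebra_simps)
qed

section \<open>One growth step\<close>

text \<open>Exchanging the two sums counts the weight of each edge once at each of its two
  ends.\<close>

lemma handshake:
  fixes G :: "('v, 'w::comm_semiring_1) wgraph"
  assumes G: "simple_wgraph G"
  shows "(\<Sum>i\<in>wverts G. strength G i) = 2 * total_weight G"
proof -
  have "(\<Sum>i\<in>wverts G. strength G i) = (\<Sum>e\<in>wedges G. \<Sum>i | i \<in> wverts G \<and> i \<in> e. weight G e)"
    unfolding strength_def
    by (rule sum.swap_restrict) (use G finite_wedges in \<open>auto simp: simple_wgraph_def\<close>)
  also have "\<dots> = (\<Sum>e\<in>wedges G. 2 * weight G e)"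
  proof (rule sum.cong[OF refl])
    fix e assume "e \<in> wedges G"
    then have "{i. i \<in> wverts G \<and> i \<in> e} = e" "card e = 2"
      using G by (auto simp: simple_wgraph_def)
    then show "(\<Sum>i | i \<in> wverts G \<and> i \<in> e. weight G e) = 2 * weight G e" by simp
  qed
  finally show ?thesis by (simp add: total_weight_def sum_distrib_left)
qed

text \<open>Growth is split into rescaling the old edges and then attaching triangles. The total
  weight becomes \<open>(1 + \<delta>) * W + 3 * W\<close> with \<open>W\<close> the old
  one.\<close>

lemma grow_facts:
  fixes G :: "(vertex, nat) wgraph"
  assumes G: "simple_wgraph G" and even: "\<And>i. i \<in> wverts G \<Longrightarrow> even (strength G i)"
    and fresh: "\<And>i k b. Born n i k b \<notin> wverts G"
    and size: "\<And>F. F \<in> spanning_trees G \<Longrightarrow> Suc (card F) = card (wverts G)"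
  shows "card (wverts (grow \<delta> n G)) = card (wverts G) + 2 * total_weight G \<and>
    total_weight (grow \<delta> n G) = (\<delta> + 4) * total_weight G \<and>
    (\<forall>F\<in>spanning_trees (grow \<delta> n G). Suc (card F) = card (wverts (grow \<delta> n G))) \<and>
    weighted_tree_count (grow \<delta> n G) =
      3 ^ total_weight G * ((1 + \<delta>) ^ (card (wverts G) - 1) * weighted_tree_count G)"
proof -
  define S where "S = (SIGMA i:wverts G. {..<strength G i div 2})"
  \<comment> \<open>\<open>H\<close> is the rescaled old graph. Its default value 1 off the edge set
    supplies the weights of the triangle edges to come.\<close>
  define H where "H = G\<lparr>weight := \<lambda>e. if e \<in> wedges G then (1 + \<delta>) * weight G e else 1\<rparr>"
  have H: "wverts H = wverts G" "wedges H = wedges G"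
    "weight H = (\<lambda>e. if e \<in> wedges G then (1 + \<delta>) * weight G e else 1)"
    by (simp_all add: H_def)
  have trees: "spanning_trees H = spanning_trees G"
    by (simp add: spanning_trees_def is_spanning_tree_def H)
  have finV: "finite (wverts G)" using G by (simp add: simple_wgraph_def)
  have "2 * card S = (\<Sum>i\<in>wverts G. 2 * (strength G i div 2))"
    using finV by (simp add: S_def sum_distrib_left)
  also have "\<dots> = 2 * total_weight G"
    using even by (simp add: handshake[OF G, symmetric])
  finally have card_S: "card S = total_weight G" by simp
  have "grow \<delta> n G = add_triangles n S H"
    by (auto simp: grow_def add_triangles_def new_verts_def new_edges_def S_def H triangle_edges_def)
  moreover have "total_weight H = (1 + \<delta>) * total_weight G"
    by (simp add: total_weight_def H sum_distrib_left)
  moreover have "weighted_tree_count H = (1 + \<delta>) ^ (card (wverts G) - 1) * weighted_tree_count G"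
  proof -
    \<comment> \<open>By \<open>size\<close>, a spanning tree has \<open>card (wverts G) - 1\<close>
      edges, and each contributes one factor \<open>1 + \<delta>\<close>.\<close>
    have "(\<Prod>e\<in>F. weight H e) = (1 + \<delta>) ^ (card (wverts G) - 1) * (\<Prod>e\<in>F. weight G e)"
      if "F \<in> spanning_trees G" for F
    proof -
      have "F \<subseteq> wedges G" using that by (simp add: spanning_trees_def is_spanning_tree_def)
      then have "(\<Prod>e\<in>F. weight H e) = (\<Prod>e\<in>F. (1 + \<delta>) * weight G e)"
        by (intro prod.cong) (auto simp: H)
      then show ?thesis using size[OF that, symmetric] by (simp only: prod.distrib prod_constant diff_Suc_1)
    qed
    then have "(\<Sum>F\<in>spanning_trees H. \<Prod>e\<in>F. weight H e) =
        (\<Sum>F\<in>spanning_trees G. (1 + \<delta>) ^ (card (wverts G) - 1) * (\<Prod>e\<in>F. weight G e))"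
      unfolding trees by (intro sum.cong) auto
    then show ?thesis
      by (simp add: weighted_tree_count_def spanning_trees_def sum_distrib_left)
  qed
  moreover have "finite S" "fst ` S \<subseteq> wverts H" "simple_wgraph H"
    using finV G by (auto simp: S_def H simple_wgraph_def)
  ultimately show ?thesis
    using add_triangles_facts[of S H n] fresh size trees card_S by (simp add: H algebra_simps)
qed

section \<open>The initial triangle and the recurrences\<close>

text \<open>A triangle is a single vertex with one triangle attached.\<close>

lemma triangle_facts:
  "card (wverts triangle) = 3" "total_weight triangle = 3" "weighted_tree_count triangle = 3"
  "F \<in> spanning_trees triangle \<Longrightarrow> Suc (card F) = card (wverts triangle)"
proof -
  define P :: "(vertex, nat) wgraph"
    where "P = \<lparr>wverts = {Corner 0}, wedges = {}, weight = \<lambda>_. 1\<rparr>"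
  interpret triangle_attachment P "Corner 0" "Corner 1" "Corner 2"
    by unfold_locales (auto simp: P_def simple_wgraph_def)
  have eq: "triangle = add_triangle P (Corner 0) (Corner 1) (Corner 2)"
    by (auto simp: triangle_def add_triangle_def P_def triangle_edges_def insert_commute)
  have "\<not> is_cycle {} c" for c :: "vertex list"
    by (cases c) (auto simp: is_cycle_def)
  \<comment> \<open>On a single vertex the empty edge set is connected by reflexivity, so it is the
    one spanning tree.\<close>
  then have trees: "spanning_trees P = {{}}"
    by (auto simp: spanning_trees_def is_spanning_tree_def P_def edges_connect_def)
  have unit: "weight P e = 1" for e by (simp add: P_def)
  show "card (wverts triangle) = 3"
    unfolding eq card_wverts_add_triangle by (simp add: P_def)
  show "total_weight triangle = 3"
    unfolding eq total_weight_add_triangle[OF unit] by (simp add: P_def total_weight_def)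
  show "weighted_tree_count triangle = 3"
    unfolding eq weighted_tree_count_add_triangle[OF unit]
    using trees by (simp add: weighted_tree_count_def spanning_trees_def)
  show "Suc (card F) = card (wverts triangle)" if "F \<in> spanning_trees triangle"
    unfolding eq
    by (rule card_spanning_tree_add_triangle) (use that trees eq in \<open>auto simp: P_def\<close>)
qed

text \<open>Discharges the \<open>size\<close> hypothesis of \<open>grow_facts\<close> at every
  stage, which makes the recurrences unconditional.\<close>

lemma W_graph_spanning_tree_size:
  "F \<in> spanning_trees (W_graph \<delta> n) \<Longrightarrow> Suc (card F) = card (wverts (W_graph \<delta> n))"
proof (induction n arbitrary: F)
  case 0
  then show ?case using triangle_facts by simp
next
  case (Suc n)
  have "Born n i k b \<notin> wverts (W_graph \<delta> n)" for i k b
    using stamp_less by blast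
  from grow_facts[OF simple_W_graph even_strength this Suc.IH] Suc.prems show ?case by simp
qed

lemma W_graph_Suc:
  "card (wverts (W_graph \<delta> (Suc n))) = card (wverts (W_graph \<delta> n)) + 2 * total_weight (W_graph \<delta> n)"
  "total_weight (W_graph \<delta> (Suc n)) = (\<delta> + 4) * total_weight (W_graph \<delta> n)"
  "weighted_tree_count (W_graph \<delta> (Suc n)) = 3 ^ total_weight (W_graph \<delta> n) *
    ((1 + \<delta>) ^ (card (wverts (W_graph \<delta> n)) - 1) * weighted_tree_count (W_graph \<delta> n))"
proof -
  have "Born n i k b \<notin> wverts (W_graph \<delta> n)" for i k b
    using stamp_less by blast
  note grow_facts[OF simple_W_graph even_strength this W_graph_spanning_tree_size, where \<delta> = \<delta>]
  then show
    "card (wverts (W_graph \<delta> (Suc n))) = card (wverts (W_graph \<delta> n)) + 2 * total_weight (W_graph \<delta> n)"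
    "total_weight (W_graph \<delta> (Suc n)) = (\<delta> + 4) * total_weight (W_graph \<delta> n)"
    "weighted_tree_count (W_graph \<delta> (Suc n)) = 3 ^ total_weight (W_graph \<delta> n) *
      ((1 + \<delta>) ^ (card (wverts (W_graph \<delta> n)) - 1) * weighted_tree_count (W_graph \<delta> n))"
    by simp_all
qed

section \<open>Solving the recurrences\<close>

lemma total_weight_W_graph: "total_weight (W_graph \<delta> n) = 3 * (\<delta> + 4) ^ n"
  by (induction n) (simp_all add: triangle_facts W_graph_Suc(2) del: W_graph.simps(2))

text \<open>The increments \<open>6 * (\<delta> + 4) ^ n\<close> form a geometric progression;
  \<open>\<delta> + 3\<close> is its ratio minus 1.\<close>

lemma card_wverts_W_graph:
  "real (card (wverts (W_graph \<delta> n))) = 3 + 6 * ((real \<delta> + 4) ^ n - 1) / (real \<delta> + 3)"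
proof (induction n)
  case 0
  show ?case by (simp add: triangle_facts)
next
  case (Suc n)
  have "real \<delta> + 3 \<noteq> 0" by (simp add: add_nonneg_eq_0_iff)
  then show ?case
    using Suc by (simp add: W_graph_Suc(1) total_weight_W_graph field_simps del: W_graph.simps(2))
qed

theorem theorem5p2:
  fixes \<delta> n :: nat
  assumes "\<delta> \<ge> 1"
  shows "real (weighted_tree_count (W_graph \<delta> n)) =
    3 powr ((3 * (real \<delta> + 4) ^ n + real \<delta>) / (real \<delta> + 3)) *
    (real \<delta> + 1) powr
      (2 * (3 * ((real \<delta> + 4) ^ n - 1) + real \<delta> * (real \<delta> + 3) * real n) / (real \<delta> + 3) ^ 2)"
proof (induction n)
  case 0
  \<comment> \<open>For \<open>n = 0\<close> the two exponents are 1 and 0.\<close>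
  have "real \<delta> + 3 \<noteq> 0" by (simp add: add_nonneg_eq_0_iff)
  then show ?case by (simp add: triangle_facts add.commute)
next
  case (Suc n)
  define d x where "d = real \<delta>" and "x = (d + 4) ^ n"
  \<comment> \<open>\<open>A\<close> and \<open>B\<close> are the claimed exponents of 3 and of
    \<open>\<delta> + 1\<close>. It remains to match their increments with \<open>?W\<close> and
    \<open>?N - 1\<close>.\<close>
  define A where "A n = (3 * (d + 4) ^ n + d) / (d + 3)" for n :: nat
  define B where "B n = 2 * (3 * ((d + 4) ^ n - 1) + d * (d + 3) * real n) / (d + 3) ^ 2" for n :: nat
  have d: "d + 3 \<noteq> 0" "d + 1 > 0" by (auto simp: d_def)
  let ?N = "card (wverts (W_graph \<delta> n))" and ?W = "total_weight (W_graph \<delta> n)"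
  \<comment> \<open>The bound makes the natural-number subtraction in \<open>?N - 1\<close> agree
    with the real one.\<close>
  have "3 \<le> real ?N"
    unfolding card_wverts_W_graph by simp
  then have "1 \<le> ?N" by linarith
  then have N: "real (?N - 1) = 2 + 6 * (x - 1) / (d + 3)"
    using card_wverts_W_graph[of \<delta> n] by (simp add: of_nat_diff d_def x_def)
  have W: "real ?W = 3 * x"
    by (simp add: total_weight_W_graph d_def x_def)
  have "A (Suc n) = real ?W + A n"
    unfolding W using d by (simp add: A_def x_def field_simps)
  then have "3 powr A (Suc n) = 3 ^ ?W * 3 powr A n"
    by (simp add: powr_add powr_realpow)
  moreover have "B (Suc n) = real (?N - 1) + B n"
  proof -
    \<comment> \<open>With \<open>y\<close> for the denominator, \<open>d + 4\<close> becomes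
      \<open>y + 1\<close> and \<open>d\<close> becomes \<open>y - 3\<close>, so clearing
      denominators leaves a polynomial identity.\<close>
    define y where "y = d + 3"
    then have y: "y \<noteq> 0" using d by simp
    have "B (Suc n) = 2 * (3 * ((y + 1) * x - 1) + (y - 3) * y * (real n + 1)) / y ^ 2"
      by (simp add: B_def x_def y_def algebra_simps)
    also have "\<dots> = 2 + 6 * (x - 1) / y + 2 * (3 * (x - 1) + (y - 3) * y * real n) / y ^ 2"
      using y by (simp add: field_simps power2_eq_square)
    also have "\<dots> = real (?N - 1) + B n"
      unfolding N by (simp add: B_def x_def y_def)
    finally show ?thesis .
  qed
  then have "(d + 1) powr B (Suc n) = (d + 1) ^ (?N - 1) * (d + 1) powr B n"
    using d by (simp add: powr_add powr_realpow)
  moreover have "real (weighted_tree_count (W_graph \<delta> n)) = 3 powr A n * (d + 1) powr B n"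
    using Suc by (simp add: A_def B_def d_def)
  ultimately have "real (weighted_tree_count (W_graph \<delta> (Suc n))) =
      3 powr A (Suc n) * (d + 1) powr B (Suc n)"
    by (simp add: W_graph_Suc(3) d_def add.commute del: W_graph.simps(2))
  then show ?case by (simp only: A_def B_def d_def)
qed

end
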